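(* Let $\mathcal J$ be a unital JC-algebra and let $\tau:\mathcal E(\mathcal J)\to\mathcal E(\mathcal J)$ be a faithful state operator. Then $\tau$ is a conditional expectation on $\mathcal E(\mathcal J)$.
   Context: A JC-algebra $\mathcal J$ is a norm-closed real linear subspace of the bounded self-adjoint operators on a complex Hilbert space $\mathcal H$, closed under the Jordan product $a\circ b=\frac12(ab+ba)$; it is assumed to contain a unit $1$ (the identity operator). $\mathcal E(\mathcal J)=\{a\in\mathcal J:0\le a\le 1\}$ is an effect algebra with $a\oplus b=a+b$ defined iff $a+b\le1$ (written $a\perp b$). A state operator on $\mathcal E(\mathcal J)$ is a map $\tau:\mathcal E(\mathcal J)\to\mathcal E(\mathcal J)$ with $\tau(1)=1$, $\tau(a+b)=\tau(a)+\tau(b)$ whenever $a\perp b$, and $\tau\circ\tau=\tau$; it is faithful if $\tau(a)=0$ implies $a=0$. A conditional expectation on $\mathcal E(\mathcal J)$ is a map $\tau:\mathcal E(\mathcal J)\to\mathcal E(\mathcal J)$ with $\tau(1)=1$, $\tau(a+b)=\tau(a)+\tau(b)$ whenever $a\perp b$, and $\tau(\tau(a)b\tau(a))=\tau(a)\tau(b)\tau(a)$ for all $a,b\in\mathcal E(\mathcal J)$. *)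

theory Defs
  imports "HOL-Analysis.Analysis"
begin

text \<open>
  Complex Hilbert spaces. The real normed structure is the underlying one: real scaling is the
  restriction of complex scaling and the norm is induced by the inner product, which is linear
  in its first argument.
\<close>

class complex_hilbert_space = banach +
  fixes scaleC :: "complex \<Rightarrow> 'a \<Rightarrow> 'a"  (infixr "*\<^sub>C" 75)
    and cinner :: "'a \<Rightarrow> 'a \<Rightarrow> complex"
  assumes scaleC_add_right: "c *\<^sub>C (x + y) = c *\<^sub>C x + c *\<^sub>C y"
    and scaleC_add_left: "(c + d) *\<^sub>C x = c *\<^sub>C x + d *\<^sub>C x"
    and scaleC_scaleC: "c *\<^sub>C (d *\<^sub>C x) = (c * d) *\<^sub>C x"
    and scaleC_one: "1 *\<^sub>C x = x"
    and scaleR_eq_scaleC: "r *\<^sub>R x = complex_of_real r *\<^sub>C x"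
    and cinner_commute: "cinner x y = cnj (cinner y x)"
    and cinner_add_left: "cinner (x + y) z = cinner x z + cinner y z"
    and cinner_scaleC_left: "cinner (c *\<^sub>C x) y = c * cinner x y"
    and cinner_self_nonneg: "cinner x x \<in> \<real>\<^sub>\<ge>\<^sub>0"
    and cinner_eq_zero_iff: "cinner x x = 0 \<longleftrightarrow> x = 0"
    and norm_eq_sqrt_cinner: "norm x = sqrt (Re (cinner x x))"

text \<open>
  Elements of \<^typ>\<open>'a \<Rightarrow>\<^sub>L 'a\<close> are bounded but only real linear, so complex linearity is
  imposed separately. The norm of this type is the operator norm.
\<close>

definition self_adjoint_operators :: "('a::complex_hilbert_space \<Rightarrow>\<^sub>L 'a) set" where
  "self_adjoint_operators =
    {a. (\<forall>c x. blinfun_apply a (c *\<^sub>C x) = c *\<^sub>C blinfun_apply a x) \<and>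
        (\<forall>x y. cinner (blinfun_apply a x) y = cinner x (blinfun_apply a y))}"

definition positive_operator :: "('a::complex_hilbert_space \<Rightarrow>\<^sub>L 'a) \<Rightarrow> bool" where
  "positive_operator a \<longleftrightarrow> (\<forall>x. cinner (blinfun_apply a x) x \<in> \<real>\<^sub>\<ge>\<^sub>0)"

definition operator_le ::
  "('a::complex_hilbert_space \<Rightarrow>\<^sub>L 'a) \<Rightarrow> ('a \<Rightarrow>\<^sub>L 'a) \<Rightarrow> bool"  (infix "\<preceq>" 50) where
  "a \<preceq> b \<longleftrightarrow> positive_operator (b - a)"

definition jordan_product ::
  "('a::complex_hilbert_space \<Rightarrow>\<^sub>L 'a) \<Rightarrow> ('a \<Rightarrow>\<^sub>L 'a) \<Rightarrow> ('a \<Rightarrow>\<^sub>L 'a)" where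
  "jordan_product a b = (1/2) *\<^sub>R ((a o\<^sub>L b) + (b o\<^sub>L a))"

definition unital_JC_algebra :: "('a::complex_hilbert_space \<Rightarrow>\<^sub>L 'a) set \<Rightarrow> bool" where
  "unital_JC_algebra J \<longleftrightarrow>
    J \<subseteq> self_adjoint_operators \<and> subspace J \<and> closed J \<and>
    (\<forall>a\<in>J. \<forall>b\<in>J. jordan_product a b \<in> J) \<and> id_blinfun \<in> J"

definition effects ::
  "('a::complex_hilbert_space \<Rightarrow>\<^sub>L 'a) set \<Rightarrow> ('a \<Rightarrow>\<^sub>L 'a) set" where
  "effects J = {a \<in> J. 0 \<preceq> a \<and> a \<preceq> id_blinfun}"

text \<open>
  Maps on \<^term>\<open>effects J\<close> are total functions on the operator type whose values outside
  \<^term>\<open>effects J\<close> are irrelevant.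
\<close>

definition unital_additive_map ::
  "('a::complex_hilbert_space \<Rightarrow>\<^sub>L 'a) set \<Rightarrow> (('a \<Rightarrow>\<^sub>L 'a) \<Rightarrow> ('a \<Rightarrow>\<^sub>L 'a)) \<Rightarrow> bool" where
  "unital_additive_map J \<tau> \<longleftrightarrow>
    \<tau> \<in> effects J \<rightarrow> effects J \<and>
    \<tau> id_blinfun = id_blinfun \<and>
    (\<forall>a\<in>effects J. \<forall>b\<in>effects J. a + b \<preceq> id_blinfun \<longrightarrow> \<tau> (a + b) = \<tau> a + \<tau> b)"

definition state_operator ::
  "('a::complex_hilbert_space \<Rightarrow>\<^sub>L 'a) set \<Rightarrow> (('a \<Rightarrow>\<^sub>L 'a) \<Rightarrow> ('a \<Rightarrow>\<^sub>L 'a)) \<Rightarrow> bool" where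
  "state_operator J \<tau> \<longleftrightarrow>
    unital_additive_map J \<tau> \<and> (\<forall>a\<in>effects J. \<tau> (\<tau> a) = \<tau> a)"

definition faithful ::
  "('a::complex_hilbert_space \<Rightarrow>\<^sub>L 'a) set \<Rightarrow> (('a \<Rightarrow>\<^sub>L 'a) \<Rightarrow> ('a \<Rightarrow>\<^sub>L 'a)) \<Rightarrow> bool" where
  "faithful J \<tau> \<longleftrightarrow> (\<forall>a\<in>effects J. \<tau> a = 0 \<longrightarrow> a = 0)"

definition conditional_expectation ::
  "('a::complex_hilbert_space \<Rightarrow>\<^sub>L 'a) set \<Rightarrow> (('a \<Rightarrow>\<^sub>L 'a) \<Rightarrow> ('a \<Rightarrow>\<^sub>L 'a)) \<Rightarrow> bool" where
  "conditional_expectation J \<tau> \<longleftrightarrow>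
    unital_additive_map J \<tau> \<and>
    (\<forall>a\<in>effects J. \<forall>b\<in>effects J.
      \<tau> (\<tau> a o\<^sub>L b o\<^sub>L \<tau> a) = \<tau> a o\<^sub>L \<tau> b o\<^sub>L \<tau> a)"

end

theory Submission
  imports Defs
begin

text \<open>
  By additivity and positivity, \<open>\<tau>\<close> extends to a unital positive linear idempotent \<open>T\<close> on \<open>J\<close>.
  It satisfies the Kadison inequality \<open>T(x)\<^sup>2 \<le> T(x\<^sup>2)\<close>: for \<open>0 \<le> x \<le> 1\<close> the Bernstein elements
  \<open>p\<^sub>k = (n choose k) x\<^sup>k (1 - x)\<^sup>n\<^sup>-\<^sup>k\<close> lie in \<open>J\<close> and are positive with sum \<open>1\<close>, mean \<open>n x\<close> and second
  moment \<open>n x + n (n - 1) x\<^sup>2\<close>; expanding \<open>0 \<le> (\<Sum>k. (k - n T(x)) T(p\<^sub>k) (k - n T(x)))\<close>, dividing by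
  \<open>n\<^sup>2\<close> and letting \<open>n\<close> grow gives the claim without functional calculus. For \<open>a\<close> fixed by \<open>T\<close>, the
  element \<open>T(a\<^sup>2) - a\<^sup>2\<close> is positive and killed by \<open>T\<close>, so it vanishes by faithfulness. The Kadison
  inequality at \<open>a + t x\<close> for all real \<open>t\<close> then forces \<open>T(a \<circ> x) = a \<circ> T(x)\<close>, and the result follows
  from \<open>a b a = 2 a \<circ> (a \<circ> b) - a\<^sup>2 \<circ> b\<close>.
\<close>

subsection \<open>Positive operators\<close>

lemma cinner_add_right: "cinner x (y + z) = cinner x y + cinner x z"
  for x y z :: "'a::complex_hilbert_space"
  by (metis cinner_add_left cinner_commute complex_cnj_add)

lemma cinner_scaleR_left: "cinner (r *\<^sub>R x) y = of_real r * cinner x y"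
  for x y :: "'a::complex_hilbert_space"
  by (simp add: scaleR_eq_scaleC cinner_scaleC_left)

lemma cinner_scaleR_right: "cinner x (r *\<^sub>R y) = of_real r * cinner x y"
  for x y :: "'a::complex_hilbert_space"
  by (metis cinner_commute cinner_scaleR_left complex_cnj_mult complex_cnj_complex_of_real)

lemma cinner_minus_left: "cinner (- x) y = - cinner x y"
  for x y :: "'a::complex_hilbert_space"
  using cinner_scaleR_left[of "-1" x y] by simp

lemma cinner_minus_right: "cinner x (- y) = - cinner x y"
  for x y :: "'a::complex_hilbert_space"
  using cinner_scaleR_right[of x "-1" y] by simp

lemma cinner_diff_left: "cinner (x - y) z = cinner x z - cinner y z"
  for x y z :: "'a::complex_hilbert_space"
  using cinner_add_left[of x "- y" z] by (simp add: cinner_minus_left)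

lemma cinner_diff_right: "cinner x (y - z) = cinner x y - cinner x z"
  for x y z :: "'a::complex_hilbert_space"
  using cinner_add_right[of x y "- z"] by (simp add: cinner_minus_right)

lemma cinner_zero_left [simp]: "cinner 0 x = 0"
  for x :: "'a::complex_hilbert_space"
  using cinner_diff_left[of 0 0 x] by simp

lemmas cinner_simps =
  cinner_add_left cinner_add_right cinner_diff_left cinner_diff_right
  cinner_minus_left cinner_minus_right cinner_scaleR_left cinner_scaleR_right

lemma Re_cinner_commute: "Re (cinner x y) = Re (cinner y x)"
  for x y :: "'a::complex_hilbert_space"
  by (subst cinner_commute) simp

lemma Re_cinner_self: "Re (cinner x x) = (norm x)\<^sup>2"
  for x :: "'a::complex_hilbert_space"
  using cinner_self_nonneg[of x]
  by (simp add: norm_eq_sqrt_cinner complex_nonneg_Reals_iff)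

text \<open>Cauchy-Schwarz is obtained from the triangle inequality, which the normed space
  structure supplies, by expanding the square of \<open>norm (x + y)\<close>.\<close>

lemma Re_cinner_le_norm: "Re (cinner x y) \<le> norm x * norm y"
  for x y :: "'a::complex_hilbert_space"
proof -
  have "(norm (x + y))\<^sup>2 \<le> (norm x + norm y)\<^sup>2"
    by (simp add: norm_triangle_ineq power_mono)
  moreover have "(norm (x + y))\<^sup>2 = (norm x)\<^sup>2 + 2 * Re (cinner x y) + (norm y)\<^sup>2"
    unfolding Re_cinner_self[symmetric]
    by (simp add: cinner_simps Re_cinner_commute[of y x])
  ultimately show ?thesis
    by (simp add: power2_eq_square algebra_simps)
qed

lemma abs_Re_cinner_le_norm: "\<bar>Re (cinner x y)\<bar> \<le> norm x * norm y"
  for x y :: "'a::complex_hilbert_space"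
  using Re_cinner_le_norm[of x y] Re_cinner_le_norm[of "- x" y]
  by (simp add: cinner_minus_left abs_le_iff)

lemmas blinfun_compose_bilinear =
  bounded_bilinear.add_left[OF bounded_bilinear_blinfun_compose]
  bounded_bilinear.add_right[OF bounded_bilinear_blinfun_compose]
  bounded_bilinear.diff_left[OF bounded_bilinear_blinfun_compose]
  bounded_bilinear.diff_right[OF bounded_bilinear_blinfun_compose]
  bounded_bilinear.scaleR_left[OF bounded_bilinear_blinfun_compose]
  bounded_bilinear.scaleR_right[OF bounded_bilinear_blinfun_compose]

lemma blinfun_compose_id [simp]: "a o\<^sub>L id_blinfun = a" "id_blinfun o\<^sub>L a = a"
  by (rule blinfun_eqI, simp)+

section \<open>Self-adjointness and positivity through quadratic forms\<close>

lemma self_adjoint_cinner: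
  assumes "a \<in> self_adjoint_operators"
  shows "cinner (a x) y = cinner x (a y)"
  using assms by (simp add: self_adjoint_operators_def)

lemma self_adjoint_cinner_real:
  assumes "a \<in> self_adjoint_operators"
  shows "cinner (a x) x \<in> \<real>"
  by (metis assms Reals_cnj_iff cinner_commute self_adjoint_cinner)

lemma positive_operator_iff:
  assumes "a \<in> self_adjoint_operators"
  shows "positive_operator a \<longleftrightarrow> (\<forall>x. 0 \<le> Re (cinner (a x) x))"
  using self_adjoint_cinner_real[OF assms]
  by (auto simp: positive_operator_def complex_nonneg_Reals_iff complex_is_Real_iff)

lemma positive_operator_cinner:
  assumes "positive_operator a"
  shows "0 \<le> Re (cinner (a x) x)"
  using assms by (auto simp: positive_operator_def complex_nonneg_Reals_iff)

text \<open>Evaluating the form at \<open>x + a x\<close> leaves only the cross terms, and by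
  self-adjointness each of them is the square of \<open>norm (a x)\<close>.\<close>

lemma self_adjoint_eq_0:
  assumes a: "a \<in> self_adjoint_operators" and "\<And>x. Re (cinner (a x) x) = 0"
  shows "a = 0"
proof (rule blinfun_eqI)
  fix x
  have "Re (cinner (a (x + a x)) (x + a x)) = 0"
    by fact
  then have "Re (cinner (a x) (a x)) + Re (cinner (a (a x)) x) = 0"
    using assms(2)[of x] assms(2)[of "a x"] by (simp add: cinner_simps blinfun.bilinear_simps)
  then have "Re (cinner (a x) (a x)) = 0"
    by (simp add: self_adjoint_cinner[OF a, of "a x" x])
  then show "a x = (0 :: 'a \<Rightarrow>\<^sub>L 'a) x"
    by (simp add: Re_cinner_self)
qed

lemma self_adjoint_eqI:
  assumes "a - b \<in> self_adjoint_operators"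
    and "\<And>x. Re (cinner (a x) x) = Re (cinner (b x) x)"
  shows "a = b"
  using self_adjoint_eq_0[OF assms(1)] assms(2) by (simp add: blinfun.bilinear_simps cinner_simps)

lemma positive_operator_0 [simp]: "positive_operator 0"
  by (simp add: positive_operator_def)

lemma positive_operator_id [simp]: "positive_operator id_blinfun"
  by (simp add: positive_operator_def cinner_self_nonneg)

lemma positive_operator_add:
  "positive_operator a \<Longrightarrow> positive_operator b \<Longrightarrow> positive_operator (a + b)"
  by (simp add: positive_operator_def blinfun.bilinear_simps cinner_simps)

lemma positive_operator_scaleR:
  "0 \<le> r \<Longrightarrow> positive_operator a \<Longrightarrow> positive_operator (r *\<^sub>R a)"
  by (simp add: positive_operator_def blinfun.bilinear_simps cinner_simps)

lemma positive_operator_sum: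
  "(\<And>i. i \<in> I \<Longrightarrow> positive_operator (f i)) \<Longrightarrow> positive_operator (sum f I)"
  by (induction I rule: infinite_finite_induct) (auto intro: positive_operator_add)

lemma positive_operator_conj:
  assumes "positive_operator a" and "b \<in> self_adjoint_operators"
  shows "positive_operator (b o\<^sub>L a o\<^sub>L b)"
  using assms by (simp add: positive_operator_def self_adjoint_cinner)

text \<open>This is nonnegativity of a variance: the difference is the sum of the conjugates of
  \<open>q i\<close> by \<open>l i - y\<close>. Factors are kept in order, since \<open>q i\<close>
  and \<open>y\<close> may fail to commute.\<close>

lemma operator_variance_nonneg:
  fixes q :: "'i \<Rightarrow> 'a::complex_hilbert_space \<Rightarrow>\<^sub>L 'a"
  assumes pos: "\<And>i. i \<in> I \<Longrightarrow> positive_operator (q i)"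
    and one: "(\<Sum>i\<in>I. q i) = id_blinfun"
    and mean: "(\<Sum>i\<in>I. l i *\<^sub>R q i) = y"
    and y: "y \<in> self_adjoint_operators"
    and sa: "\<And>r. r *\<^sub>R id_blinfun - y \<in> self_adjoint_operators"
  shows "positive_operator ((\<Sum>i\<in>I. (l i)\<^sup>2 *\<^sub>R q i) - (y o\<^sub>L y))"
proof -
  let ?d = "\<lambda>i. l i *\<^sub>R id_blinfun - y"
  have "(\<Sum>i\<in>I. ?d i o\<^sub>L q i o\<^sub>L ?d i) =
    (\<Sum>i\<in>I. (l i)\<^sup>2 *\<^sub>R q i - (y o\<^sub>L (l i *\<^sub>R q i)) - ((l i *\<^sub>R q i) o\<^sub>L y) + (y o\<^sub>L q i o\<^sub>L y))"
    by (intro sum.cong refl)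
      (simp add: blinfun_compose_bilinear power2_eq_square algebra_simps)
  also have "\<dots> = (\<Sum>i\<in>I. (l i)\<^sup>2 *\<^sub>R q i) - (y o\<^sub>L (\<Sum>i\<in>I. l i *\<^sub>R q i))
      - ((\<Sum>i\<in>I. l i *\<^sub>R q i) o\<^sub>L y) + (y o\<^sub>L (\<Sum>i\<in>I. q i) o\<^sub>L y)"
    by (simp add: sum.distrib sum_subtractf
        bounded_bilinear.sum_left[OF bounded_bilinear_blinfun_compose]
        bounded_bilinear.sum_right[OF bounded_bilinear_blinfun_compose])
  also have "\<dots> = (\<Sum>i\<in>I. (l i)\<^sup>2 *\<^sub>R q i) - (y o\<^sub>L y)"
    by (simp add: one mean)
  finally show ?thesis
    using positive_operator_sum[of I "\<lambda>i. ?d i o\<^sub>L q i o\<^sub>L ?d i"]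
      positive_operator_conj[OF pos sa] by simp
qed

subsection \<open>Bernstein operators\<close>

text \<open>These are the binomial probabilities of \<open>k\<close> successes in \<open>n\<close>
  trials with success probability \<open>x\<close>. The recursion conditions on one trial, so that
  Pascal's rule replaces binomial coefficients and operator powers.\<close>

fun bernstein_operator :: "('a::real_normed_vector \<Rightarrow>\<^sub>L 'a) \<Rightarrow> nat \<Rightarrow> nat \<Rightarrow> ('a \<Rightarrow>\<^sub>L 'a)" where
  "bernstein_operator x 0 k = (if k = 0 then id_blinfun else 0)"
| "bernstein_operator x (Suc n) 0 = (id_blinfun - x) o\<^sub>L bernstein_operator x n 0"
| "bernstein_operator x (Suc n) (Suc k) =
    (x o\<^sub>L bernstein_operator x n k) + ((id_blinfun - x) o\<^sub>L bernstein_operator x n (Suc k))"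

lemma bernstein_operator_eq_0: "n < k \<Longrightarrow> bernstein_operator x n k = 0"
  by (induction x n k rule: bernstein_operator.induct) auto

text \<open>One further trial either succeeds, which shifts the argument of \<open>g\<close>, or
  fails, which leaves it. The moments of order 0, 1 and 2 follow from this by induction.\<close>

lemma sum_bernstein_operator_Suc:
  "(\<Sum>k\<le>Suc n. g k *\<^sub>R bernstein_operator x (Suc n) k) =
    (x o\<^sub>L (\<Sum>k\<le>n. g (Suc k) *\<^sub>R bernstein_operator x n k)) +
    ((id_blinfun - x) o\<^sub>L (\<Sum>k\<le>n. g k *\<^sub>R bernstein_operator x n k))"
proof -
  let ?B = "bernstein_operator x n"
  have "(\<Sum>k\<le>n. g k *\<^sub>R ?B k) = (\<Sum>k\<le>Suc n. g k *\<^sub>R ?B k)"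
    by (simp add: bernstein_operator_eq_0)
  also have "\<dots> = g 0 *\<^sub>R ?B 0 + (\<Sum>k\<le>n. g (Suc k) *\<^sub>R ?B (Suc k))"
    by (rule sum.atMost_Suc_shift)
  finally show ?thesis
    by (simp add: sum.atMost_Suc_shift scaleR_add_right sum.distrib blinfun_compose_bilinear
        bounded_bilinear.sum_right[OF bounded_bilinear_blinfun_compose] del: sum.atMost_Suc)
qed

lemma sum_bernstein_operator_0: "(\<Sum>k\<le>n. bernstein_operator x n k) = id_blinfun"
proof (induction n)
  case (Suc n)
  then show ?case
    using sum_bernstein_operator_Suc[of "\<lambda>_. 1" x n] by simp
qed simp

text \<open>The offset \<open>c\<close> makes the induction work, because the success branch turns
  \<open>c\<close> into \<open>c + 1\<close>. The second moment below carries it for the same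
  reason.\<close>

lemma sum_bernstein_operator_1:
  "(\<Sum>k\<le>n. (real k + c) *\<^sub>R bernstein_operator x n k) = real n *\<^sub>R x + c *\<^sub>R id_blinfun"
proof (induction n arbitrary: c)
  case (Suc n)
  have "(\<Sum>k\<le>n. (real (Suc k) + c) *\<^sub>R bernstein_operator x n k) =
      real n *\<^sub>R x + (c + 1) *\<^sub>R id_blinfun"
    using Suc[of "c + 1"] by (simp add: algebra_simps)
  then show ?case
    unfolding sum_bernstein_operator_Suc Suc
    by (simp add: blinfun_compose_bilinear algebra_simps)
qed simp

lemma sum_bernstein_operator_2:
  fixes x :: "'a::real_normed_vector \<Rightarrow>\<^sub>L 'a"
  shows "(\<Sum>k\<le>n. (real k + c)\<^sup>2 *\<^sub>R bernstein_operator x n k) =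
    (real n + 2 * c * real n) *\<^sub>R x + (real n * (real n - 1)) *\<^sub>R (x o\<^sub>L x) + c\<^sup>2 *\<^sub>R id_blinfun"
proof (induction n arbitrary: c)
  case (Suc n)
  have shift: "(\<Sum>k\<le>n. (real (Suc k) + c)\<^sup>2 *\<^sub>R bernstein_operator x n k) =
    (real n + 2 * (c + 1) * real n) *\<^sub>R x + (real n * (real n - 1)) *\<^sub>R (x o\<^sub>L x)
      + (c + 1)\<^sup>2 *\<^sub>R id_blinfun"
    using Suc[of "c + 1"] by (simp add: add_ac)
  have "(r * 3) *\<^sub>R y = r *\<^sub>R y + (r *\<^sub>R y + r *\<^sub>R y)" for r and y :: "'a \<Rightarrow>\<^sub>L 'a"
    by (simp flip: scaleR_add_left)
  then show ?case
    unfolding sum_bernstein_operator_Suc shift Suc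
    by (simp add: blinfun_compose_bilinear algebra_simps power2_eq_square)
qed simp

subsection \<open>Unital JC-algebras\<close>

text \<open>In the expansion of the right-hand side the words \<open>a a b\<close> and
  \<open>b a a\<close> cancel. The identity shows that \<open>J\<close> is closed under conjugation
  and reduces conjugation to Jordan products.\<close>

lemma conj_eq_jordan_product:
  fixes a b :: "'a::complex_hilbert_space \<Rightarrow>\<^sub>L 'a"
  shows "a o\<^sub>L b o\<^sub>L a =
    2 *\<^sub>R jordan_product a (jordan_product a b) - jordan_product (a o\<^sub>L a) b"
proof (rule blinfun_eqI)
  fix v
  have "a (b (a v)) = (1/2 + 1/2) *\<^sub>R a (b (a v))"
    by simp
  also have "\<dots> = (1/2) *\<^sub>R a (b (a v)) + (1/2) *\<^sub>R a (b (a v))"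
    by (rule scaleR_add_left)
  finally show "(a o\<^sub>L b o\<^sub>L a) v =
    (2 *\<^sub>R jordan_product a (jordan_product a b) - jordan_product (a o\<^sub>L a) b) v"
    by (simp add: jordan_product_def blinfun.bilinear_simps algebra_simps)
qed

locale JC_algebra =
  fixes J :: "('a::complex_hilbert_space \<Rightarrow>\<^sub>L 'a) set"
  assumes unital_JC_algebra: "unital_JC_algebra J"
begin

lemma self_adjoint_mem: "a \<in> J \<Longrightarrow> a \<in> self_adjoint_operators"
  and add_mem: "a \<in> J \<Longrightarrow> b \<in> J \<Longrightarrow> a + b \<in> J"
  and diff_mem: "a \<in> J \<Longrightarrow> b \<in> J \<Longrightarrow> a - b \<in> J"
  and scaleR_mem: "a \<in> J \<Longrightarrow> r *\<^sub>R a \<in> J"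
  and sum_mem: "(\<And>i. i \<in> I \<Longrightarrow> f i \<in> J) \<Longrightarrow> sum f I \<in> J"
  and zero_mem: "0 \<in> J"
  and id_mem: "id_blinfun \<in> J"
  and jordan_product_mem: "a \<in> J \<Longrightarrow> b \<in> J \<Longrightarrow> jordan_product a b \<in> J"
  using unital_JC_algebra unfolding unital_JC_algebra_def
  by (auto intro: subspace_add subspace_diff subspace_scale subspace_sum subspace_0)

lemma compose_mem:
  assumes "a \<in> J" "b \<in> J" "a o\<^sub>L b = b o\<^sub>L a"
  shows "a o\<^sub>L b \<in> J"
proof -
  have "jordan_product a b = a o\<^sub>L b"
    by (simp add: jordan_product_def assms(3) flip: scaleR_2)
  with jordan_product_mem[OF assms(1,2)] show ?thesis
    by simp
qed

lemma square_mem: "a \<in> J \<Longrightarrow> a o\<^sub>L a \<in> J"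
  by (simp add: compose_mem)

lemma conj_mem: "a \<in> J \<Longrightarrow> b \<in> J \<Longrightarrow> a o\<^sub>L b o\<^sub>L a \<in> J"
  unfolding conj_eq_jordan_product
  by (intro diff_mem scaleR_mem jordan_product_mem square_mem)

lemma mem_effects_iff:
  "a \<in> effects J \<longleftrightarrow> a \<in> J \<and> positive_operator a \<and> positive_operator (id_blinfun - a)"
  by (auto simp: effects_def operator_le_def)

lemma positive_operator_mem_iff:
  "a \<in> J \<Longrightarrow> positive_operator a \<longleftrightarrow> (\<forall>x. 0 \<le> Re (cinner (a x) x))"
  by (simp add: positive_operator_iff self_adjoint_mem)

lemma mem_effects_iff_cinner:
  assumes "a \<in> J"
  shows "a \<in> effects J \<longleftrightarrow>
    (\<forall>x. 0 \<le> Re (cinner (a x) x) \<and> Re (cinner (a x) x) \<le> (norm x)\<^sup>2)"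
  using assms
  by (auto simp: mem_effects_iff positive_operator_mem_iff diff_mem id_mem
      blinfun.bilinear_simps cinner_simps Re_cinner_self)

text \<open>With \<open>y = 1 - x\<close>, the product \<open>y x\<close> equals
  \<open>x y x + y x y\<close>, a sum of two conjugates of positive operators.\<close>

lemma compose_compl_positive:
  assumes "x \<in> effects J"
  shows "positive_operator ((id_blinfun - x) o\<^sub>L x)"
proof -
  have "(id_blinfun - x) o\<^sub>L x =
    (x o\<^sub>L (id_blinfun - x) o\<^sub>L x) + ((id_blinfun - x) o\<^sub>L x o\<^sub>L (id_blinfun - x))"
    by (rule blinfun_eqI) (simp add: blinfun.bilinear_simps algebra_simps)
  moreover have "positive_operator \<dots>"
    using assms
    by (intro positive_operator_add positive_operator_conj)
      (auto simp: mem_effects_iff self_adjoint_mem diff_mem id_mem)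
  ultimately show ?thesis
    by simp
qed

text \<open>The chain is \<open>a b a \<le> a a \<le> a \<le> 1\<close>, read through quadratic
  forms; the middle step is positivity of \<open>(1 - a) a\<close>.\<close>

lemma conj_mem_effects:
  assumes "a \<in> effects J" "b \<in> effects J"
  shows "a o\<^sub>L b o\<^sub>L a \<in> effects J"
proof -
  have a: "a \<in> J" "a \<in> self_adjoint_operators" and b: "b \<in> J"
    using assms by (auto simp: mem_effects_iff self_adjoint_mem)
  have "Re (cinner (a (b (a x))) x) \<le> (norm x)\<^sup>2" for x
  proof -
    have "Re (cinner (a (b (a x))) x) = Re (cinner (b (a x)) (a x))"
      by (simp add: self_adjoint_cinner[OF a(2)])
    also have "\<dots> \<le> (norm (a x))\<^sup>2"
      using assms(2) b by (simp add: mem_effects_iff_cinner)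
    also have "\<dots> = Re (cinner (a (a x)) x)"
      by (simp add: self_adjoint_cinner[OF a(2), of "a x"] Re_cinner_self)
    also have "\<dots> \<le> Re (cinner (a x) x)"
      using positive_operator_cinner[OF compose_compl_positive[OF assms(1)], of x]
      by (simp add: blinfun.bilinear_simps cinner_simps)
    also have "\<dots> \<le> (norm x)\<^sup>2"
      using assms(1) a by (simp add: mem_effects_iff_cinner)
    finally show ?thesis .
  qed
  moreover have "0 \<le> Re (cinner (a (b (a x))) x)" for x
    using positive_operator_cinner[OF positive_operator_conj[OF _ a(2), of b], of x] assms(2)
    by (simp add: mem_effects_iff)
  ultimately show ?thesis
    using conj_mem[OF a(1) b] by (simp add: mem_effects_iff_cinner)
qed

text \<open>
  The last three positivity conditions make this set stable under left multiplication by \<open>x\<close> and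
  by \<open>1 - x\<close>; this avoids square roots in showing that products of commuting positive operators
  are positive.
\<close>

definition bernstein_cone :: "('a \<Rightarrow>\<^sub>L 'a) \<Rightarrow> ('a \<Rightarrow>\<^sub>L 'a) set" where
  "bernstein_cone x = {c \<in> J. x o\<^sub>L c = c o\<^sub>L x \<and> positive_operator c \<and>
    positive_operator (x o\<^sub>L c) \<and> positive_operator ((id_blinfun - x) o\<^sub>L c) \<and>
    positive_operator ((id_blinfun - x) o\<^sub>L x o\<^sub>L c)}"

lemma bernstein_cone_add:
  "c \<in> bernstein_cone x \<Longrightarrow> d \<in> bernstein_cone x \<Longrightarrow> c + d \<in> bernstein_cone x"
  by (auto simp: bernstein_cone_def blinfun_compose_bilinear(1,2)
      intro!: add_mem positive_operator_add)

lemma bernstein_cone_zero: "0 \<in> bernstein_cone x"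
  by (simp add: bernstein_cone_def zero_mem)

lemma bernstein_cone_id: "x \<in> effects J \<Longrightarrow> id_blinfun \<in> bernstein_cone x"
  using compose_compl_positive by (simp add: bernstein_cone_def id_mem mem_effects_iff)

text \<open>Since \<open>c\<close> commutes with \<open>x\<close>, a repeated factor
  \<open>x\<close> or \<open>1 - x\<close> can be moved to both ends. Each required product is thus
  one of the four operators known to be positive or a conjugate of one of them.\<close>

lemma bernstein_cone_compose:
  assumes x: "x \<in> effects J" and c: "c \<in> bernstein_cone x"
  shows "x o\<^sub>L c \<in> bernstein_cone x" "(id_blinfun - x) o\<^sub>L c \<in> bernstein_cone x"
proof -
  let ?y = "id_blinfun - x"
  have J: "x \<in> J" "?y \<in> J" "c \<in> J"
    and eq: "x o\<^sub>L c = c o\<^sub>L x" "?y o\<^sub>L c = c o\<^sub>L ?y"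
    using x c
    by (auto simp: bernstein_cone_def mem_effects_iff diff_mem id_mem blinfun_compose_bilinear)
  have comm: "c (x v) = x (c v)" for v
    by (metis blinfun_apply_blinfun_compose eq(1))
  have pos: "positive_operator c" "positive_operator (x o\<^sub>L c)" "positive_operator (?y o\<^sub>L c)"
    "positive_operator (?y o\<^sub>L x o\<^sub>L c)"
    using c by (auto simp: bernstein_cone_def)
  note conj_x = positive_operator_conj[OF _ self_adjoint_mem[OF J(1)]]
  note conj_y = positive_operator_conj[OF _ self_adjoint_mem[OF J(2)]]
  note simps = comm blinfun.bilinear_simps algebra_simps
  have "x o\<^sub>L (x o\<^sub>L c) = x o\<^sub>L c o\<^sub>L x"
    "?y o\<^sub>L (x o\<^sub>L c) = ?y o\<^sub>L x o\<^sub>L c"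
    "?y o\<^sub>L x o\<^sub>L (x o\<^sub>L c) = x o\<^sub>L (?y o\<^sub>L c) o\<^sub>L x"
    by (rule blinfun_eqI, simp add: simps)+
  then show "x o\<^sub>L c \<in> bernstein_cone x"
    using compose_mem[OF J(1,3) eq(1)] pos conj_x[OF pos(1)] conj_x[OF pos(3)]
    by (simp add: bernstein_cone_def)
  have "x o\<^sub>L (?y o\<^sub>L c) = ?y o\<^sub>L x o\<^sub>L c"
    "?y o\<^sub>L c o\<^sub>L x = ?y o\<^sub>L x o\<^sub>L c"
    "?y o\<^sub>L (?y o\<^sub>L c) = ?y o\<^sub>L c o\<^sub>L ?y"
    "?y o\<^sub>L x o\<^sub>L (?y o\<^sub>L c) = ?y o\<^sub>L (x o\<^sub>L c) o\<^sub>L ?y"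
    by (rule blinfun_eqI, simp add: simps)+
  then show "?y o\<^sub>L c \<in> bernstein_cone x"
    using compose_mem[OF J(2,3) eq(2)] pos conj_y[OF pos(1)] conj_y[OF pos(2)]
    by (simp add: bernstein_cone_def)
qed

lemma bernstein_operator_mem_cone:
  "x \<in> effects J \<Longrightarrow> bernstein_operator x n k \<in> bernstein_cone x"
  by (induction x n k rule: bernstein_operator.induct)
    (auto intro: bernstein_cone_add bernstein_cone_zero bernstein_cone_id bernstein_cone_compose)

lemma bernstein_operator_mem: "x \<in> effects J \<Longrightarrow> bernstein_operator x n k \<in> J"
  and bernstein_operator_positive:
    "x \<in> effects J \<Longrightarrow> positive_operator (bernstein_operator x n k)"
  using bernstein_operator_mem_cone by (auto simp: bernstein_cone_def)

text \<open>The affine image of \<open>x\<close> that maps the interval from \<open>-r\<close> to \<open>r\<close> onto the unit interval.\<close>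

definition rescale :: "real \<Rightarrow> ('a \<Rightarrow>\<^sub>L 'a) \<Rightarrow> ('a \<Rightarrow>\<^sub>L 'a)" where
  "rescale r x = (1 / (2 * r)) *\<^sub>R x + (1/2) *\<^sub>R id_blinfun"

text \<open>Cauchy-Schwarz bounds the form of \<open>x\<close> by \<open>r\<close> times the squared
  norm, so \<open>x\<close> lies between \<open>-r\<close> and \<open>r\<close>.\<close>

lemma rescale_mem_effects:
  assumes x: "x \<in> J" and r: "norm x \<le> r" "0 < r"
  shows "rescale r x \<in> effects J"
proof -
  have "\<bar>Re (cinner (x v) v)\<bar> \<le> r * (norm v)\<^sup>2" for v
  proof -
    have "\<bar>Re (cinner (x v) v)\<bar> \<le> norm (x v) * norm v"
      by (rule abs_Re_cinner_le_norm)
    also have "\<dots> \<le> (norm x * norm v) * norm v"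
      by (intro mult_right_mono norm_blinfun) auto
    also have "\<dots> \<le> (r * norm v) * norm v"
      using r by (intro mult_right_mono) auto
    finally show ?thesis
      by (simp add: power2_eq_square)
  qed
  then have "0 \<le> Re (cinner (x v) v) + r * (norm v)\<^sup>2" "Re (cinner (x v) v) \<le> r * (norm v)\<^sup>2" for v
    by (smt (verit))+
  then show ?thesis
    using r x unfolding rescale_def
    by (subst mem_effects_iff_cinner)
      (auto simp: add_mem scaleR_mem id_mem blinfun.bilinear_simps cinner_simps Re_cinner_self
        field_simps intro!: add_mem scaleR_mem id_mem)
qed

lemma rescale_inverse: "0 < r \<Longrightarrow> x = (2 * r) *\<^sub>R rescale r x - r *\<^sub>R id_blinfun"
  by (simp add: rescale_def scaleR_add_right)

end

subsection \<open>The Kadison inequality\<close>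

lemma nonneg_of_quadratic_bound:
  fixes a b c :: real
  assumes "\<And>n. 0 < n \<Longrightarrow> 0 \<le> real n * a + real n * (real n - 1) * b - (real n)\<^sup>2 * c"
  shows "0 \<le> b - c"
proof (rule ccontr)
  assume "\<not> 0 \<le> b - c"
  \<comment> \<open>The bound divided by \<open>n\<close> is \<open>(a - b) - n (c - b)\<close>,
    which is negative for this \<open>n\<close>. The absolute value also excludes
    \<open>n = 0\<close>.\<close>
  then obtain n where n: "\<bar>a - b\<bar> < real n * (c - b)"
    using reals_Archimedean3[of "c - b"] by auto
  then have "0 < n"
    by (cases n) auto
  have "0 \<le> real n * ((a - b) - real n * (c - b))"
    using assms[OF \<open>0 < n\<close>] by (simp add: power2_eq_square algebra_simps)
  with \<open>0 < n\<close> n show False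
    by (simp add: zero_le_mult_iff)
qed

lemma linear_coefficient_eq_0:
  fixes d e :: real
  assumes "\<And>t. 0 \<le> 2 * t * d + t\<^sup>2 * e"
  shows "d = 0"
proof -
  \<comment> \<open>A strictly positive upper bound for \<open>e\<close>; at
    \<open>t = - d / f\<close> the expression is then at most
    \<open>- d\<^sup>2 / f\<close>.\<close>
  define f where "f = \<bar>e\<bar> + 1"
  have f: "0 < f" "e \<le> f"
    by (simp_all add: f_def)
  have "0 \<le> 2 * (- d / f) * d + (- d / f)\<^sup>2 * e"
    by fact
  also have "\<dots> \<le> 2 * (- d / f) * d + (- d / f)\<^sup>2 * f"
    using f by (intro add_left_mono mult_left_mono) auto
  also have "\<dots> = - (d\<^sup>2 / f)"
    using f by (simp add: field_simps power2_eq_square)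
  finally show ?thesis
    using f by (simp add: field_simps)
qed

locale positive_unital_map = JC_algebra J
  for J :: "('a::complex_hilbert_space \<Rightarrow>\<^sub>L 'a) set" +
  fixes T :: "('a \<Rightarrow>\<^sub>L 'a) \<Rightarrow> ('a \<Rightarrow>\<^sub>L 'a)"
  assumes map_mem: "x \<in> J \<Longrightarrow> T x \<in> J"
    and map_id: "T id_blinfun = id_blinfun"
    and map_add: "x \<in> J \<Longrightarrow> y \<in> J \<Longrightarrow> T (x + y) = T x + T y"
    and map_scaleR: "x \<in> J \<Longrightarrow> T (r *\<^sub>R x) = r *\<^sub>R T x"
    and map_positive: "x \<in> J \<Longrightarrow> positive_operator x \<Longrightarrow> positive_operator (T x)"
begin

lemma map_diff: "x \<in> J \<Longrightarrow> y \<in> J \<Longrightarrow> T (x - y) = T x - T y"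
  using map_add[of x "(-1) *\<^sub>R y"] map_scaleR[of y "-1"] scaleR_mem[of y "-1"] by simp

lemma map_zero: "T 0 = 0"
  using map_scaleR[OF id_mem, of 0] by simp

lemma map_sum: "(\<And>i. i \<in> I \<Longrightarrow> f i \<in> J) \<Longrightarrow> T (sum f I) = (\<Sum>i\<in>I. T (f i))"
  by (induction I rule: infinite_finite_induct) (auto simp: map_zero map_add sum_mem)

text \<open>
  The Bernstein operators of \<open>x\<close> form a positive partition of unity whose second moment exceeds
  \<open>x\<^sup>2\<close> only by \<open>(x - x\<^sup>2) / n\<close>.
\<close>

lemma kadison_effect:
  assumes x: "x \<in> effects J"
  shows "positive_operator (T (x o\<^sub>L x) - (T x o\<^sub>L T x))"
proof -
  have xJ: "x \<in> J"
    using x by (simp add: mem_effects_iff)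
  have "positive_operator
    (real n *\<^sub>R T x + (real n * (real n - 1)) *\<^sub>R T (x o\<^sub>L x) - (real n)\<^sup>2 *\<^sub>R (T x o\<^sub>L T x))" for n
  proof -
    let ?B = "bernstein_operator x n"
    have T_sum: "(\<Sum>k\<le>n. g k *\<^sub>R T (?B k)) = T (\<Sum>k\<le>n. g k *\<^sub>R ?B k)" for g
      using x by (subst map_sum) (auto simp: map_scaleR scaleR_mem bernstein_operator_mem)
    have "positive_operator
      ((\<Sum>k\<le>n. (real k)\<^sup>2 *\<^sub>R T (?B k)) - (real n *\<^sub>R T x o\<^sub>L real n *\<^sub>R T x))"
    proof (rule operator_variance_nonneg)
      show "(\<Sum>k\<le>n. T (?B k)) = id_blinfun"
        using T_sum[of "\<lambda>_. 1"] by (simp add: sum_bernstein_operator_0 map_id)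
      show "(\<Sum>k\<le>n. real k *\<^sub>R T (?B k)) = real n *\<^sub>R T x"
        unfolding T_sum using sum_bernstein_operator_1[of 0 x n] xJ by (simp add: map_scaleR)
    qed (use x xJ in \<open>auto intro!: map_positive self_adjoint_mem diff_mem scaleR_mem id_mem
        map_mem bernstein_operator_mem bernstein_operator_positive\<close>)
    moreover have "(\<Sum>k\<le>n. (real k)\<^sup>2 *\<^sub>R T (?B k)) =
        real n *\<^sub>R T x + (real n * (real n - 1)) *\<^sub>R T (x o\<^sub>L x)"
      unfolding T_sum using sum_bernstein_operator_2[of 0 x n] xJ square_mem[OF xJ]
      by (simp add: map_add map_scaleR scaleR_mem)
    ultimately show ?thesis
      by (simp add: blinfun_compose_bilinear power2_eq_square)
  qed
  from positive_operator_cinner[OF this]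
  have "0 \<le> Re (cinner ((T (x o\<^sub>L x) - (T x o\<^sub>L T x)) v) v)" for v
    using nonneg_of_quadratic_bound[of "Re (cinner (T x v) v)" "Re (cinner (T (x o\<^sub>L x) v) v)"
        "Re (cinner (T x (T x v)) v)"]
    by (simp add: blinfun.bilinear_simps cinner_simps)
  then show ?thesis
    by (subst positive_operator_mem_iff) (simp_all add: diff_mem map_mem square_mem xJ)
qed

text \<open>Adding a multiple of \<open>1\<close> to \<open>x\<close> does not change the defect
  \<open>T(x x) - T(x) T(x)\<close>, and scaling \<open>x\<close> multiplies it by the square of the
  factor. The case of effects therefore suffices.\<close>

lemma kadison:
  assumes x: "x \<in> J"
  shows "positive_operator (T (x o\<^sub>L x) - (T x o\<^sub>L T x))"
proof -
  define r where "r = norm x + 1"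
  have r: "0 < r" "norm x \<le> r"
    by (simp_all add: r_def add_nonneg_pos)
  define e where "e = rescale r x"
  have e: "e \<in> effects J" "e \<in> J"
    using rescale_mem_effects[OF x r(2,1)] by (simp_all add: e_def mem_effects_iff)
  have x_eq: "x = (2 * r) *\<^sub>R e - r *\<^sub>R id_blinfun"
    using rescale_inverse[OF r(1)] by (simp add: e_def)
  have Tx: "T x = (2 * r) *\<^sub>R T e - r *\<^sub>R id_blinfun"
    using e by (simp add: x_eq map_diff map_scaleR map_id scaleR_mem id_mem)
  have double: "(r * (r * 4)) *\<^sub>R v = (r * (r * 2)) *\<^sub>R v + (r * (r * 2)) *\<^sub>R v" for v :: 'a
    by (simp flip: scaleR_add_left)
  have "x o\<^sub>L x = (4 * r\<^sup>2) *\<^sub>R (e o\<^sub>L e) - (4 * r\<^sup>2) *\<^sub>R e + r\<^sup>2 *\<^sub>R id_blinfun"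
    by (rule blinfun_eqI) (simp add: x_eq double blinfun.bilinear_simps algebra_simps power2_eq_square)
  then have Txx:
    "T (x o\<^sub>L x) = (4 * r\<^sup>2) *\<^sub>R T (e o\<^sub>L e) - (4 * r\<^sup>2) *\<^sub>R T e + r\<^sup>2 *\<^sub>R id_blinfun"
    using e by (simp add: map_diff map_add map_scaleR map_id scaleR_mem id_mem diff_mem square_mem)
  have "T (x o\<^sub>L x) - (T x o\<^sub>L T x) = (4 * r\<^sup>2) *\<^sub>R (T (e o\<^sub>L e) - (T e o\<^sub>L T e))"
    unfolding Txx Tx
    by (rule blinfun_eqI) (simp add: double blinfun.bilinear_simps algebra_simps power2_eq_square)
  then show ?thesis
    using kadison_effect[OF e(1)] by (simp add: positive_operator_scaleR)
qed

end

subsection \<open>Faithful projections\<close>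

locale faithful_projection = positive_unital_map +
  assumes map_map: "x \<in> J \<Longrightarrow> T (T x) = T x"
    and map_eq_0: "x \<in> J \<Longrightarrow> positive_operator x \<Longrightarrow> T x = 0 \<Longrightarrow> x = 0"
begin

lemma map_square:
  assumes "a \<in> J" "T a = a"
  shows "T (a o\<^sub>L a) = a o\<^sub>L a"
proof -
  have "T (a o\<^sub>L a) - (a o\<^sub>L a) = 0"
  proof (rule map_eq_0)
    show "T (a o\<^sub>L a) - (a o\<^sub>L a) \<in> J"
      using assms by (simp add: diff_mem map_mem square_mem)
    show "positive_operator (T (a o\<^sub>L a) - (a o\<^sub>L a))"
      using kadison[OF assms(1)] assms(2) by simp
    show "T (T (a o\<^sub>L a) - (a o\<^sub>L a)) = 0"
      using assms by (simp add: map_diff map_map map_mem square_mem)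
  qed
  then show ?thesis
    by simp
qed

text \<open>
  In the Kadison inequality at \<open>x + t a\<close> the terms of second order in \<open>t\<close> cancel, so the
  coefficient of \<open>t\<close> vanishes.
\<close>

lemma map_jordan_product:
  assumes a: "a \<in> J" "T a = a" and x: "x \<in> J"
  shows "T (jordan_product a x) = jordan_product a (T x)"
proof (rule self_adjoint_eqI)
  show "T (jordan_product a x) - jordan_product a (T x) \<in> self_adjoint_operators"
    using a x by (intro self_adjoint_mem diff_mem map_mem jordan_product_mem)
  fix v
  \<comment> \<open>At \<open>a + t x\<close> the constant terms of the Kadison defect cancel, since
    \<open>a\<close> and its square are fixed. Its form at \<open>v\<close> has \<open>d\<close> as
    coefficient of \<open>2 t\<close> and \<open>e\<close> as coefficient of
    \<open>t\<^sup>2\<close>.\<close>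
  define d where
    "d = Re (cinner (T (jordan_product a x) v) v) - Re (cinner (jordan_product a (T x) v) v)"
  define e where "e = Re (cinner (T (x o\<^sub>L x) v) v) - Re (cinner ((T x o\<^sub>L T x) v) v)"
  have "0 \<le> 2 * t * d + t\<^sup>2 * e" for t
  proof -
    let ?z = "a + t *\<^sub>R x"
    have sq: "(b + t *\<^sub>R y) o\<^sub>L (b + t *\<^sub>R y) =
        (b o\<^sub>L b) + (2 * t) *\<^sub>R jordan_product b y + t\<^sup>2 *\<^sub>R (y o\<^sub>L y)" for b y
      by (rule blinfun_eqI)
        (simp add: jordan_product_def blinfun.bilinear_simps algebra_simps power2_eq_square)
    have "T (?z o\<^sub>L ?z) =
        (a o\<^sub>L a) + (2 * t) *\<^sub>R T (jordan_product a x) + t\<^sup>2 *\<^sub>R T (x o\<^sub>L x)"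
      unfolding sq using a x
      by (simp add: map_add map_scaleR map_square add_mem scaleR_mem square_mem jordan_product_mem)
    moreover have "T ?z = a + t *\<^sub>R T x"
      using a x by (simp add: map_add map_scaleR scaleR_mem)
    moreover have "?z \<in> J"
      using a x by (simp add: add_mem scaleR_mem)
    ultimately have "positive_operator
        ((2 * t) *\<^sub>R T (jordan_product a x) - (2 * t) *\<^sub>R jordan_product a (T x)
          + t\<^sup>2 *\<^sub>R T (x o\<^sub>L x) - t\<^sup>2 *\<^sub>R (T x o\<^sub>L T x))"
      using kadison[of ?z] by (simp add: sq algebra_simps)
    from positive_operator_cinner[OF this, of v] show ?thesis
      by (simp add: d_def e_def blinfun.bilinear_simps cinner_simps algebra_simps)
  qed
  then have "d = 0"
    by (rule linear_coefficient_eq_0)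
  then show "Re (cinner (T (jordan_product a x) v) v) = Re (cinner (jordan_product a (T x) v) v)"
    by (simp add: d_def)
qed

text \<open>The Jordan expression for \<open>a x a\<close> multiplies by \<open>a\<close> twice and
  by the square of \<open>a\<close> once. Both multipliers are fixed, so \<open>T\<close> passes
  through each Jordan product.\<close>

lemma map_conj:
  assumes "a \<in> J" "T a = a" "x \<in> J"
  shows "T (a o\<^sub>L x o\<^sub>L a) = a o\<^sub>L T x o\<^sub>L a"
  unfolding conj_eq_jordan_product using assms
  by (simp add: map_diff map_scaleR map_jordan_product map_square map_mem
      scaleR_mem jordan_product_mem square_mem)

end

subsection \<open>Linear extension of additive maps on effects\<close>

text \<open>Additivity fixes \<open>g\<close> at the multiples of \<open>1/n\<close>, and
  nonnegativity makes \<open>g\<close> monotone. Squeezing \<open>t\<close> between neighbouring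
  multiples gives an error of at most \<open>g 1 / n\<close>.\<close>

lemma additive_on_unit_interval_linear:
  fixes g :: "real \<Rightarrow> real"
  assumes add: "\<And>s t. 0 \<le> s \<Longrightarrow> 0 \<le> t \<Longrightarrow> s + t \<le> 1 \<Longrightarrow> g (s + t) = g s + g t"
    and nonneg: "\<And>t. 0 \<le> t \<Longrightarrow> t \<le> 1 \<Longrightarrow> 0 \<le> g t"
    and t: "0 \<le> t" "t \<le> 1"
  shows "g t = t * g 1"
\<comment> \<open>For \<open>t < 1\<close> the upper neighbour \<open>(m + 1) / n\<close> still lies
  in the unit interval.\<close>
proof (cases "t = 1")
  case False
  have g0: "g 0 = 0"
    using add[of 0 0] by simp
  have mono: "g u \<le> g v" if "0 \<le> u" "u \<le> v" "v \<le> 1" for u v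
    using add[of u "v - u"] nonneg[of "v - u"] that by simp
  have multiple: "g (real m * s) = real m * g s" if "0 \<le> s" "real m * s \<le> 1" for m s
    using that
  proof (induction m)
    case (Suc m)
    then show ?case
      using add[of s "real m * s"] by (simp add: algebra_simps)
  qed (simp add: g0)
  have "real n * \<bar>g t - t * g 1\<bar> \<le> g 1" if n: "0 < n" for n
  proof -
    define m where "m = nat \<lfloor>t * real n\<rfloor>"
    have m: "real m \<le> t * real n" "t * real n < real m + 1"
      using t by (simp_all add: m_def)
    have "t * real n < real n"
      using t False n by simp
    then have "real m < real n"
      using m(1) by linarith
    then have "real (Suc m) \<le> real n"
      by simp
    have frac: "real n * g (real k / real n) = real k * g 1" if "k \<le> n" for k
      using multiple[of "1 / real n" k] multiple[of "1 / real n" n] that n by (simp add: field_simps)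
    have "real n * g (real m / real n) \<le> real n * g t"
      "real n * g t \<le> real n * g (real (Suc m) / real n)"
      using m n t \<open>real (Suc m) \<le> real n\<close>
      by (intro mult_left_mono mono; simp add: field_simps)+
    then have "real m * g 1 \<le> real n * g t" "real n * g t \<le> (real m + 1) * g 1"
      using \<open>real (Suc m) \<le> real n\<close> frac[of m] frac[of "Suc m"]
      by (simp_all only: of_nat_le_iff of_nat_Suc Suc_leD add.commute)
    moreover have "real m * g 1 \<le> (t * real n) * g 1" "(t * real n) * g 1 \<le> (real m + 1) * g 1"
      using m nonneg[of 1] by (intro mult_right_mono; simp)+
    ultimately have "\<bar>real n * g t - (t * real n) * g 1\<bar> \<le> g 1"
      by (simp add: abs_le_iff algebra_simps)
    also have "real n * g t - (t * real n) * g 1 = real n * (g t - t * g 1)"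
      by (simp add: algebra_simps)
    finally show ?thesis
      by (simp add: abs_mult)
  qed
  then have "\<not> 0 < \<bar>g t - t * g 1\<bar>"
    using reals_Archimedean3[of "\<bar>g t - t * g 1\<bar>"] nonneg[of 1]
    by (metis gr0I linorder_not_le mult_zero_left of_nat_0 zero_le_one order_refl)
  then show ?thesis
    by simp
qed simp

section \<open>Scaling and subconvex combinations of effects\<close>

context JC_algebra
begin

lemma effects_mem: "a \<in> effects J \<Longrightarrow> a \<in> J"
  by (simp add: mem_effects_iff)

lemma id_mem_effects: "id_blinfun \<in> effects J"
  by (simp add: mem_effects_iff id_mem)

lemma subconvex_mem_effects:
  assumes "a \<in> effects J" "b \<in> effects J" "0 \<le> t" "0 \<le> u" "t + u \<le> 1"
  shows "t *\<^sub>R a + u *\<^sub>R b \<in> effects J"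
proof -
  have "id_blinfun - (t *\<^sub>R a + u *\<^sub>R b) =
      t *\<^sub>R (id_blinfun - a) + u *\<^sub>R (id_blinfun - b) + (1 - t - u) *\<^sub>R id_blinfun"
    by (simp add: algebra_simps)
  moreover have "positive_operator \<dots>"
    using assms by (intro positive_operator_add positive_operator_scaleR) (auto simp: mem_effects_iff)
  ultimately show ?thesis
    using assms
    by (simp add: mem_effects_iff add_mem scaleR_mem positive_operator_add positive_operator_scaleR)
qed

lemma scaleR_mem_effects:
  "a \<in> effects J \<Longrightarrow> 0 \<le> t \<Longrightarrow> t \<le> 1 \<Longrightarrow> t *\<^sub>R a \<in> effects J"
  using subconvex_mem_effects[of a a t 0] by simp

lemma positive_scaleR_mem_effects:
  assumes "x \<in> J" "positive_operator x" "norm x \<le> r" "0 < r"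
  shows "(1 / r) *\<^sub>R x \<in> effects J"
proof -
  have "id_blinfun - (1 / r) *\<^sub>R x = 2 *\<^sub>R (id_blinfun - rescale r x)"
    using assms(4) by (simp add: rescale_def scaleR_diff_right scaleR_add_right scaleR_2)
  moreover have "positive_operator (2 *\<^sub>R (id_blinfun - rescale r x))"
    using rescale_mem_effects[OF assms(1,3,4)]
    by (intro positive_operator_scaleR) (auto simp: mem_effects_iff)
  ultimately show ?thesis
    using assms by (simp add: mem_effects_iff scaleR_mem positive_operator_scaleR)
qed

end

locale effect_map = JC_algebra J
  for J :: "('a::complex_hilbert_space \<Rightarrow>\<^sub>L 'a) set" +
  fixes \<tau> :: "('a \<Rightarrow>\<^sub>L 'a) \<Rightarrow> ('a \<Rightarrow>\<^sub>L 'a)"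
  assumes unital_additive_map: "unital_additive_map J \<tau>"
begin

lemma tau_mem: "a \<in> effects J \<Longrightarrow> \<tau> a \<in> effects J"
  and tau_id: "\<tau> id_blinfun = id_blinfun"
  and tau_add: "a \<in> effects J \<Longrightarrow> b \<in> effects J \<Longrightarrow> a + b \<in> effects J \<Longrightarrow> \<tau> (a + b) = \<tau> a + \<tau> b"
  using unital_additive_map by (auto simp: unital_additive_map_def effects_def)

text \<open>For each \<open>v\<close> the form of \<open>\<tau> (s a)\<close> at \<open>v\<close> is
  additive and nonnegative in \<open>s\<close>, so positivity takes the place of continuity.\<close>

lemma tau_scaleR:
  assumes a: "a \<in> effects J" and t: "0 \<le> t" "t \<le> 1"
  shows "\<tau> (t *\<^sub>R a) = t *\<^sub>R \<tau> a"
proof (rule self_adjoint_eqI)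
  show "\<tau> (t *\<^sub>R a) - t *\<^sub>R \<tau> a \<in> self_adjoint_operators"
    using a t by (intro self_adjoint_mem diff_mem scaleR_mem effects_mem tau_mem scaleR_mem_effects)
  fix v
  define g where "g s = Re (cinner (\<tau> (s *\<^sub>R a) v) v)" for s
  have "g t = t * g 1"
  proof (rule additive_on_unit_interval_linear)
    show "g (s + u) = g s + g u" if "0 \<le> s" "0 \<le> u" "s + u \<le> 1" for s u
      using that tau_add[of "s *\<^sub>R a" "u *\<^sub>R a"] scaleR_mem_effects[OF a]
      by (simp add: g_def scaleR_add_left blinfun.bilinear_simps cinner_simps flip: scaleR_add_left)
    show "0 \<le> g s" if "0 \<le> s" "s \<le> 1" for s
      unfolding g_def using tau_mem[OF scaleR_mem_effects[OF a that]]
      by (intro positive_operator_cinner) (simp add: mem_effects_iff)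
  qed (use t in auto)
  then show "Re (cinner (\<tau> (t *\<^sub>R a) v) v) = Re (cinner ((t *\<^sub>R \<tau> a) v) v)"
    by (simp add: g_def blinfun.bilinear_simps cinner_simps)
qed

lemma tau_subconvex:
  assumes "a \<in> effects J" "b \<in> effects J" "0 \<le> t" "0 \<le> u" "t + u \<le> 1"
  shows "\<tau> (t *\<^sub>R a + u *\<^sub>R b) = t *\<^sub>R \<tau> a + u *\<^sub>R \<tau> b"
  using assms by (subst tau_add) (auto simp: tau_scaleR scaleR_mem_effects subconvex_mem_effects)

text \<open>This applies \<open>\<tau>\<close> to the single effect \<open>rescale r x\<close> and
  undoes the affine change of scale, which avoids splitting \<open>x\<close> into positive and
  negative parts.\<close>

definition extension_bound :: "real \<Rightarrow> ('a \<Rightarrow>\<^sub>L 'a) \<Rightarrow> ('a \<Rightarrow>\<^sub>L 'a)" where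
  "extension_bound r x = (2 * r) *\<^sub>R \<tau> (rescale r x) - r *\<^sub>R id_blinfun"

definition extension :: "('a \<Rightarrow>\<^sub>L 'a) \<Rightarrow> ('a \<Rightarrow>\<^sub>L 'a)" where
  "extension x = extension_bound (norm x + 1) x"

lemma extension_eq_bound:
  assumes "x \<in> J" "norm x + 1 \<le> r"
  shows "extension x = extension_bound r x"
proof -
  define s where "s = norm x + 1"
  have s: "0 < s" "norm x \<le> s" "s \<le> r" "0 < r"
    using assms(2) by (simp_all add: s_def add_nonneg_pos less_le_trans[of 0 "norm x + 1"])
  \<comment> \<open>Enlarging the radius mixes \<open>rescale s x\<close> with the identity. The
    weights add up to \<open>(r + s) / (2 r)\<close>, at most 1, and \<open>\<tau>\<close> respects
    such combinations.\<close>
  have "rescale r x = (s / r) *\<^sub>R rescale s x + ((r - s) / (2 * r)) *\<^sub>R id_blinfun"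
    using s by (simp add: rescale_def scaleR_add_right field_simps flip: scaleR_add_left)
  then have "\<tau> (rescale r x) = (s / r) *\<^sub>R \<tau> (rescale s x) + ((r - s) / (2 * r)) *\<^sub>R id_blinfun"
    using s tau_subconvex[OF rescale_mem_effects[OF assms(1) s(2,1)] id_mem_effects,
        of "s / r" "(r - s) / (2 * r)"]
    by (simp add: tau_id field_simps)
  then show ?thesis
    using s unfolding extension_def s_def[symmetric] extension_bound_def
    by (simp add: scaleR_add_right scaleR_diff_left)
qed

lemma extension_effect:
  assumes "a \<in> effects J"
  shows "extension a = \<tau> a"
proof -
  define r where "r = norm a + 1"
  have r: "1 \<le> r"
    by (simp add: r_def)
  have "\<tau> (rescale r a) = (1 / (2 * r)) *\<^sub>R \<tau> a + (1/2) *\<^sub>R id_blinfun"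
    unfolding rescale_def using r
    by (subst tau_subconvex[OF assms id_mem_effects]) (auto simp: tau_id field_simps)
  then show ?thesis
    using r unfolding extension_def r_def[symmetric] extension_bound_def
    by (simp add: scaleR_add_right)
qed

lemma extension_mem: "x \<in> J \<Longrightarrow> extension x \<in> J"
  unfolding extension_def extension_bound_def
  by (intro diff_mem scaleR_mem id_mem effects_mem[OF tau_mem] rescale_mem_effects)
    (auto simp: add_nonneg_pos)

text \<open>With radii \<open>r\<close> and \<open>s\<close>, the rescaling of \<open>x + y\<close>
  at radius \<open>r + s\<close> is a convex combination of the two rescalings; independence of the
  radius permits \<open>r + s\<close>.\<close>

lemma extension_add:
  assumes x: "x \<in> J" and y: "y \<in> J"
  shows "extension (x + y) = extension x + extension y"
proof -
  define r s where "r = norm x + 1" and "s = norm y + 1"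
  have r: "0 < r" "norm x \<le> r" and s: "0 < s" "norm y \<le> s"
    by (simp_all add: r_def s_def add_nonneg_pos)
  have "norm (x + y) + 1 \<le> r + s"
    using norm_triangle_ineq[of x y] by (simp add: r_def s_def)
  then have "extension (x + y) = extension_bound (r + s) (x + y)"
    using x y by (intro extension_eq_bound add_mem)
  moreover have "rescale (r + s) (x + y) =
      (r / (r + s)) *\<^sub>R rescale r x + (s / (r + s)) *\<^sub>R rescale s y"
  proof -
    have half: "(r / (r + s)) * (1/2) + (s / (r + s)) * (1/2) = 1/2"
    proof -
      have "r / (r + s) + s / (r + s) = 1"
        using r s by (simp flip: add_divide_distrib)
      then show ?thesis
        by (metis distrib_right mult_1)
    qed
    have "(r / (r + s)) *\<^sub>R rescale r x + (s / (r + s)) *\<^sub>R rescale s y =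
        (1 / (2 * (r + s))) *\<^sub>R (x + y)
          + ((r / (r + s)) * (1/2) + (s / (r + s)) * (1/2)) *\<^sub>R id_blinfun"
      using r s by (simp add: rescale_def scaleR_add_right scaleR_add_left mult.commute)
    then show ?thesis
      unfolding half by (simp add: rescale_def)
  qed
  moreover have "\<tau> \<dots> = (r / (r + s)) *\<^sub>R \<tau> (rescale r x) + (s / (r + s)) *\<^sub>R \<tau> (rescale s y)"
    using r s x y by (intro tau_subconvex rescale_mem_effects) (auto simp flip: add_divide_distrib)
  moreover have "(2 * r + 2 * s) * r / (r + s) = 2 * r" "(2 * r + 2 * s) * s / (r + s) = 2 * s"
    using r s by (simp_all add: field_simps)
  ultimately show ?thesis
    unfolding extension_def r_def[symmetric] s_def[symmetric] extension_bound_def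
    by (simp add: scaleR_add_right scaleR_diff_left scaleR_add_left[of r s] distrib_left)
qed

lemma extension_scaleR_pos:
  assumes x: "x \<in> J" and c: "0 < c"
  shows "extension (c *\<^sub>R x) = c *\<^sub>R extension x"
proof -
  \<comment> \<open>The summand \<open>1 / c\<close> makes \<open>c r\<close> large enough as a
    radius for \<open>c x\<close>.\<close>
  define r where "r = norm x + 1 + 1 / c"
  have "norm x + 1 \<le> r" "norm (c *\<^sub>R x) + 1 \<le> c * r"
    using c by (simp_all add: r_def algebra_simps)
  moreover have "rescale (c * r) (c *\<^sub>R x) = rescale r x"
    using c by (simp add: rescale_def)
  ultimately show ?thesis
    using extension_eq_bound[OF x, of r] extension_eq_bound[OF scaleR_mem[OF x], of c "c * r"]
    by (simp add: extension_bound_def scaleR_diff_right mult_ac)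
qed

lemma extension_scaleR:
  assumes x: "x \<in> J"
  shows "extension (c *\<^sub>R x) = c *\<^sub>R extension x"
proof -
  have zero: "extension 0 = 0"
    using extension_add[OF zero_mem zero_mem] by simp
  consider "0 < c" | "c = 0" | "0 < - c"
    by linarith
  then show ?thesis
  proof cases
    case 3
    have "extension (c *\<^sub>R x) + extension ((- c) *\<^sub>R x) = 0"
      using extension_add[OF scaleR_mem[OF x] scaleR_mem[OF x], of c "- c"] zero by simp
    then show ?thesis
      using extension_scaleR_pos[OF x 3] by simp
  qed (use x extension_scaleR_pos zero in auto)
qed

text \<open>The affine formula subtracts a multiple of \<open>1\<close>, which hides positivity.
  Here \<open>x / r\<close> is itself an effect, and homogeneity gives a form from which both
  positivity and faithfulness can be read off.\<close>

lemma extension_positive_eq: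
  assumes "x \<in> J" "positive_operator x" "norm x \<le> r" "0 < r"
  shows "extension x = r *\<^sub>R \<tau> ((1 / r) *\<^sub>R x)"
  using assms extension_scaleR[of "(1 / r) *\<^sub>R x" r] positive_scaleR_mem_effects[OF assms]
  by (simp add: extension_effect scaleR_mem)

lemma extension_positive:
  assumes "x \<in> J" "positive_operator x"
  shows "positive_operator (extension x)"
proof -
  have r: "norm x \<le> norm x + 1" "0 < norm x + 1"
    by (simp_all add: add_nonneg_pos)
  show ?thesis
    unfolding extension_positive_eq[OF assms r]
    using tau_mem[OF positive_scaleR_mem_effects[OF assms r]] r
    by (intro positive_operator_scaleR) (auto simp: mem_effects_iff)
qed

sublocale positive_unital_map J extension
  by unfold_locales
    (auto simp: extension_mem extension_add extension_scaleR extension_positive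
      extension_effect id_mem_effects tau_id)

end

theorem theorem5p7:
  fixes J :: "('a::complex_hilbert_space \<Rightarrow>\<^sub>L 'a) set"
    and \<tau> :: "('a \<Rightarrow>\<^sub>L 'a) \<Rightarrow> ('a \<Rightarrow>\<^sub>L 'a)"
  assumes "unital_JC_algebra J"
    and "state_operator J \<tau>"
    and "faithful J \<tau>"
  shows "conditional_expectation J \<tau>"
proof -
  have tau: "unital_additive_map J \<tau>" and tau_tau: "\<And>a. a \<in> effects J \<Longrightarrow> \<tau> (\<tau> a) = \<tau> a"
    using assms(2) by (auto simp: state_operator_def)
  interpret effect_map J \<tau>
    by unfold_locales (fact assms(1) tau)+
  interpret faithful_projection J extension
  proof
    \<comment> \<open>\<open>extension x\<close> is an affine combination of \<open>1\<close> and a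
      value of \<open>\<tau>\<close>, and both are fixed by the extension.\<close>
    show "extension (extension x) = extension x" if x: "x \<in> J" for x
    proof -
      define r where "r = norm x + 1"
      have "rescale r x \<in> effects J"
        using x by (intro rescale_mem_effects) (auto simp: r_def add_nonneg_pos)
      moreover have "extension x = (2 * r) *\<^sub>R \<tau> (rescale r x) - r *\<^sub>R id_blinfun"
        by (simp add: extension_def extension_bound_def r_def)
      ultimately show ?thesis
        by (simp add: map_diff map_scaleR map_id scaleR_mem id_mem effects_mem tau_mem
            extension_effect tau_tau)
    qed
    show "x = 0" if x: "x \<in> J" "positive_operator x" "extension x = 0" for x
    proof -
      have r: "norm x \<le> norm x + 1" "0 < norm x + 1"
        by (simp_all add: add_nonneg_pos)
      have "\<tau> ((1 / (norm x + 1)) *\<^sub>R x) = 0"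
        using x(3) r unfolding extension_positive_eq[OF x(1,2) r] by simp
      then have "(1 / (norm x + 1)) *\<^sub>R x = 0"
        using assms(3) positive_scaleR_mem_effects[OF x(1,2) r] unfolding faithful_def by blast
      then show ?thesis
        using r(2) by (metis divide_eq_0_iff less_irrefl scaleR_eq_0_iff zero_neq_one)
    qed
  qed
  \<comment> \<open>The conjugate of \<open>b\<close> by \<open>\<tau> a\<close> is an effect, so
    the extension in \<open>map_conj\<close> agrees with \<open>\<tau>\<close> there.\<close>
  have "\<tau> (\<tau> a o\<^sub>L b o\<^sub>L \<tau> a) = \<tau> a o\<^sub>L \<tau> b o\<^sub>L \<tau> a" if a: "a \<in> effects J" and b: "b \<in> effects J" for a b
    using map_conj[of "\<tau> a" b] conj_mem_effects[OF tau_mem[OF a] b] a b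
    by (simp add: extension_effect tau_tau tau_mem effects_mem)
  with tau show ?thesis
    by (simp add: conditional_expectation_def)
qed

end
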